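(* Fix constants $\tau\ge\epsilon>0$ independent of $n$. Place $n$ sensors on $[0,\infty)$ at the first $n$ arrival times $X_1<\dots<X_n$ of a homogeneous Poisson process on $[0,\infty)$ with rate $n$. Then any sensor displacement algorithm which solves the $\left(\frac{1+\epsilon}{n},\frac{1+\tau}{n}\right)$-interference problem requires expected $1$-total movement of at least $\Omega(n)$.
   Context: A sensor displacement algorithm assigns to each sensor (as a function of the initial positions) a final position in $[0,\infty)$. For $0<s\le v$, it solves the $(s,v)$-interference problem if, in the final configuration, every two consecutive sensors (consecutive in the order of final positions) are at distance at least $s$ and at most $v$. If the $i$-th sensor is displaced by a distance $|m(i)|$, the $1$-total movement is $\sum_{i=1}^n|m(i)|$. Asymptotics are as $n\to\infty$. *)

theory Defs
  imports "HOL-Probability.Probability"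
begin

text \<open>A homogeneous Poisson process, given by its counting process: \<open>N t\<close> is the number of
  arrivals in \<open>[0, t]\<close>.  Paths are nondecreasing, so the truncated subtraction on \<^typ>\<open>nat\<close>
  in the increments is the true difference.\<close>

locale poisson_process = prob_space M
  for M :: "'w measure" and rate :: real and N :: "real \<Rightarrow> 'w \<Rightarrow> nat" +
  assumes rate_pos: "0 < rate"
    and measurable_count: "\<And>t. 0 \<le> t \<Longrightarrow> N t \<in> measurable M (count_space UNIV)"
    and count_0: "\<And>\<omega>. \<omega> \<in> space M \<Longrightarrow> N 0 \<omega> = 0"
    and count_mono: "\<And>\<omega>. \<omega> \<in> space M \<Longrightarrow> mono_on {0..} (\<lambda>t. N t \<omega>)"
    and count_right_cont:
      "\<And>\<omega> t. \<omega> \<in> space M \<Longrightarrow> 0 \<le> t \<Longrightarrow> continuous (at_right t) (\<lambda>u. N u \<omega>)"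
    and poisson_increments:
      "\<And>s t. 0 \<le> s \<Longrightarrow> s < t \<Longrightarrow>
         distr M (count_space UNIV) (\<lambda>\<omega>. N t \<omega> - N s \<omega>)
           = measure_pmf (poisson_pmf (rate * (t - s)))"
    and indep_increments:
      "\<And>ts. sorted_wrt (<) ts \<Longrightarrow> set ts \<subseteq> {0..} \<Longrightarrow>
         indep_vars (\<lambda>_. count_space UNIV)
           (\<lambda>k \<omega>. N (ts ! Suc k) \<omega> - N (ts ! k) \<omega>) {..<length ts - 1}"

text \<open>The set below is nonempty almost surely; by right-continuity the infimum is then attained.\<close>

definition arrival_time :: "(real \<Rightarrow> 'w \<Rightarrow> nat) \<Rightarrow> nat \<Rightarrow> 'w \<Rightarrow> real" where
  "arrival_time N k \<omega> = Inf {t. 0 \<le> t \<and> k \<le> N t \<omega>}"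

definition first_arrivals :: "(real \<Rightarrow> 'w \<Rightarrow> nat) \<Rightarrow> nat \<Rightarrow> 'w \<Rightarrow> real list" where
  "first_arrivals N n \<omega> = map (\<lambda>k. arrival_time N k \<omega>) [1..<Suc n]"

text \<open>Sensors are indexed by list position: entry \<open>i\<close> of \<open>x\<close> is the initial, and entry \<open>i\<close> of
  \<open>A x\<close> the final position of the same sensor, so an algorithm need not preserve the order
  of the sensors.  It may depend on the number of sensors, which is \<^term>\<open>length x\<close>.\<close>

definition initial_configuration :: "nat \<Rightarrow> real list \<Rightarrow> bool" where
  "initial_configuration n x \<longleftrightarrow> length x = n \<and> sorted_wrt (<) x \<and> set x \<subseteq> {0..}"

definition displacement_algorithm :: "(real list \<Rightarrow> real list) \<Rightarrow> bool" where
  "displacement_algorithm A \<longleftrightarrow>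
     (\<forall>n x. initial_configuration n x \<longrightarrow> length (A x) = n \<and> set (A x) \<subseteq> {0..})"

definition consecutive_distances_within :: "real \<Rightarrow> real \<Rightarrow> real list \<Rightarrow> bool" where
  "consecutive_distances_within s v y \<longleftrightarrow>
     (\<forall>k. Suc k < length y \<longrightarrow>
        s \<le> sort y ! Suc k - sort y ! k \<and> sort y ! Suc k - sort y ! k \<le> v)"

definition solves_interference ::
    "nat \<Rightarrow> real \<Rightarrow> real \<Rightarrow> (real list \<Rightarrow> real list) \<Rightarrow> bool" where
  "solves_interference n s v A \<longleftrightarrow>
     (\<forall>x. initial_configuration n x \<longrightarrow> consecutive_distances_within s v (A x))"

definition total_movement :: "real list \<Rightarrow> real list \<Rightarrow> real" where
  "total_movement x y = (\<Sum>i<length x. \<bar>y ! i - x ! i\<bar>)"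

text \<open>Taken in \<^typ>\<open>ennreal\<close>, as the expectation may be infinite.  For a non-measurable algorithm
  this is the lower integral, so lower bounds on it need no measurability assumption.\<close>

definition expected_movement ::
    "'w measure \<Rightarrow> (real \<Rightarrow> 'w \<Rightarrow> nat) \<Rightarrow> nat \<Rightarrow> (real list \<Rightarrow> real list) \<Rightarrow> ennreal" where
  "expected_movement M N n A =
     (\<integral>\<^sup>+ \<omega>. ennreal (total_movement (first_arrivals N n \<omega>) (A (first_arrivals N n \<omega>))) \<partial>M)"

end

theory Submission
  imports Defs
begin

text \<open>The sorted final positions are at least \<open>k (1 + \<epsilon>) / n\<close> for \<open>k < n\<close>, so they sum to
  at least \<open>(1 + \<epsilon>) (n - 1) / 2\<close>, whereas the initial positions sum to \<open>(n + 1) / 2\<close> in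
  expectation.  The total movement dominates the difference of the two sums, whichever sensor goes
  where.\<close>

section \<open>Two facts on probability spaces\<close>

text \<open>The intersection of all \<open>C m\<close> has probability at most every
  \<open>e m\<close>, hence is null. Below, \<open>C m\<close> is the event that a desired property
  fails at scale \<open>m\<close>.\<close>

lemma (in prob_space) AE_ex_notin:
  assumes "\<And>m. C m \<in> events" and "\<And>m. prob (C m) \<le> e m" and "e \<longlonglongrightarrow> 0"
  shows "AE \<omega> in M. \<exists>m::nat. \<omega> \<notin> C m"
proof -
  have "(\<Inter>m. C m) \<in> events"
    using assms(1) by auto
  moreover have "prob (\<Inter>m. C m) \<le> e m" for m
    using finite_measure_mono[of "\<Inter>m. C m" "C m"] assms(1,2)[of m] by fastforce
  then have "prob (\<Inter>m. C m) \<le> 0"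
    by (intro LIMSEQ_le_const[OF assms(3)]) auto
  ultimately have "AE \<omega> in M. \<omega> \<notin> (\<Inter>m. C m)"
    by (intro AE_not_in) (auto simp: null_sets_def emeasure_eq_measure measure_le_0_iff)
  then show ?thesis
    by auto
qed

text \<open>Layer-cake formula: the positive part of \<open>X\<close> is the length of the interval
  from 0 to \<open>X\<close>, and Tonelli exchanges the two integrals.\<close>

lemma (in prob_space) nn_integral_eq_tail_integral:
  fixes X :: "'a \<Rightarrow> real"
  assumes [measurable]: "X \<in> borel_measurable M"
  shows "(\<integral>\<^sup>+\<omega>. ennreal (X \<omega>) \<partial>M)
    = (\<integral>\<^sup>+t. ennreal (prob {\<omega> \<in> space M. t < X \<omega>}) * indicator {0<..} t \<partial>lborel)"
proof -
  interpret P: pair_sigma_finite M lborel ..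
  \<comment> \<open>The region below the graph is written as a set of pairs, so that the integrand
    is visibly measurable on the product space.\<close>
  let ?g = "\<lambda>\<omega> t. indicator {x. 0 < snd x \<and> snd x < X (fst x)} (\<omega>, t) :: ennreal"
  have "(\<integral>\<^sup>+\<omega>. ennreal (X \<omega>) \<partial>M) = (\<integral>\<^sup>+\<omega>. (\<integral>\<^sup>+t. ?g \<omega> t \<partial>lborel) \<partial>M)"
  proof (rule nn_integral_cong)
    fix \<omega>
    have "(\<integral>\<^sup>+t. ?g \<omega> t \<partial>lborel) = (\<integral>\<^sup>+t. indicator {0<..<X \<omega>} t \<partial>lborel)"
      by (intro nn_integral_cong) (auto split: split_indicator)
    then show "ennreal (X \<omega>) = (\<integral>\<^sup>+t. ?g \<omega> t \<partial>lborel)"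
      \<comment> \<open>For negative \<open>X \<omega>\<close> both sides vanish:
        \<open>ennreal\<close> truncates to 0 and the interval is empty.\<close>
      by (cases "0 \<le> X \<omega>") (auto simp: ennreal_neg)
  qed
  also have "\<dots> = (\<integral>\<^sup>+t. (\<integral>\<^sup>+\<omega>. ?g \<omega> t \<partial>M) \<partial>lborel)"
    by (rule P.Fubini'[symmetric]) measurable
  also have "\<dots> = (\<integral>\<^sup>+t. ennreal (prob {\<omega> \<in> space M. t < X \<omega>}) * indicator {0<..} t \<partial>lborel)"
  proof (rule nn_integral_cong)
    fix t :: real
    have "(\<integral>\<^sup>+\<omega>. ?g \<omega> t \<partial>M)
      = (\<integral>\<^sup>+\<omega>. indicator {0<..} t * indicator {\<omega> \<in> space M. t < X \<omega>} \<omega> \<partial>M)"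
      by (intro nn_integral_cong) (auto split: split_indicator)
    also have "\<dots> = indicator {0<..} t * (\<integral>\<^sup>+\<omega>. indicator {\<omega> \<in> space M. t < X \<omega>} \<omega> \<partial>M)"
      by (rule nn_integral_cmult) measurable
    finally show "(\<integral>\<^sup>+\<omega>. ?g \<omega> t \<partial>M)
      = ennreal (prob {\<omega> \<in> space M. t < X \<omega>}) * indicator {0<..} t"
      by (simp add: emeasure_eq_measure mult.commute)
  qed
  finally show ?thesis .
qed

section \<open>Counts of a Poisson process\<close>

context poisson_process
begin

lemma measurable_count' [measurable]: "0 \<le> t \<Longrightarrow> N t \<in> measurable M (count_space UNIV)"
  by (rule measurable_count)

lemma count_le: "\<omega> \<in> space M \<Longrightarrow> 0 \<le> s \<Longrightarrow> s \<le> t \<Longrightarrow> N s \<omega> \<le> N t \<omega>"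
  using count_mono[of \<omega>] by (auto simp: mono_on_def)

lemma prob_increment_less:
  assumes "0 \<le> s" and "s < t"
  shows "prob {\<omega> \<in> space M. N t \<omega> - N s \<omega> < k}
    = (\<Sum>j<k. (rate * (t - s)) ^ j / fact j * exp (- (rate * (t - s))))"
proof -
  have [measurable]: "N t \<in> measurable M (count_space UNIV)" "N s \<in> measurable M (count_space UNIV)"
    using assms by auto
  have "prob {\<omega> \<in> space M. N t \<omega> - N s \<omega> < k}
    = measure (distr M (count_space UNIV) (\<lambda>\<omega>. N t \<omega> - N s \<omega>)) {..<k}"
    by (subst measure_distr) (auto intro!: arg_cong[of _ _ prob])
  also have "\<dots> = (\<Sum>j<k. pmf (poisson_pmf (rate * (t - s))) j)"
    using assms by (simp add: poisson_increments measure_measure_pmf_finite)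
  finally show ?thesis
    using assms rate_pos by simp
qed

text \<open>A Poisson weight, read as a function of \<open>t\<close>, is an Erlang density divided
  by the rate. In this form the tails of the arrival times can be integrated using that densities
  have total mass 1.\<close>

lemma prob_count_less:
  assumes "0 < t"
  shows "prob {\<omega> \<in> space M. N t \<omega> < k} = (\<Sum>j<k. erlang_density j rate t) / rate"
proof -
  have "{\<omega> \<in> space M. N t \<omega> < k} = {\<omega> \<in> space M. N t \<omega> - N 0 \<omega> < k}"
    using count_0 by auto
  then show ?thesis
    using assms rate_pos prob_increment_less[of 0 t k]
    by (simp add: erlang_density_def sum_divide_distrib power_mult_distrib mult.assoc)
qed

text \<open>For fixed \<open>k\<close>, the probability of fewer than \<open>k\<close> arrivals by
  time \<open>m + 1\<close> is a finite sum of powers over an exponential and tends to 0.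
  Consequently the infimum defining an arrival time is almost surely over a nonempty set.\<close>

lemma AE_count_unbounded: "AE \<omega> in M. \<forall>k. \<exists>t\<ge>0. k \<le> N t \<omega>"
proof -
  have "AE \<omega> in M. \<exists>t\<ge>0. k \<le> N t \<omega>" for k
  proof -
    let ?C = "\<lambda>m. {\<omega> \<in> space M. N (real (Suc m)) \<omega> < k}"
    let ?e = "\<lambda>m. \<Sum>j<k. (rate * real (Suc m)) ^ j / exp (rate * real (Suc m)) / fact j"
    have *: "filterlim (\<lambda>m. rate * real (Suc m)) at_top sequentially"
      by (rule filterlim_tendsto_pos_mult_at_top[OF tendsto_const rate_pos
            filterlim_compose[OF filterlim_real_sequentially filterlim_Suc]])
    have "?e \<longlonglongrightarrow> (\<Sum>j<k. 0 / fact j)"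
      by (intro tendsto_sum tendsto_divide tendsto_const
          filterlim_compose[OF tendsto_power_div_exp_0 *]) auto
    then have "?e \<longlonglongrightarrow> 0"
      by simp
    moreover have "erlang_density j rate t / rate = (rate * t) ^ j / exp (rate * t) / fact j"
      if "0 < t" for j t
      using that rate_pos
      by (simp add: erlang_density_def power_mult_distrib exp_minus field_simps)
    then have "prob (?C m) \<le> ?e m" for m
      by (simp add: prob_count_less sum_divide_distrib del: of_nat_Suc)
    ultimately have "AE \<omega> in M. \<exists>m. \<omega> \<notin> ?C m"
      by (intro AE_ex_notin) measurable
    then show ?thesis
    proof (rule AE_mp, intro AE_I2 impI)
      fix \<omega> assume "\<omega> \<in> space M" "\<exists>m. \<omega> \<notin> ?C m"
      then obtain m where "k \<le> N (real (Suc m)) \<omega>"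
        by (auto simp: not_less simp del: of_nat_Suc)
      then show "\<exists>t\<ge>0. k \<le> N t \<omega>"
        by (intro exI[of _ "real (Suc m)"]) auto
    qed
  qed
  then show ?thesis
    by (simp add: AE_all_countable)
qed

section \<open>Arrival times and their expectations\<close>

text \<open>The infimum is attained: points with count at least \<open>k\<close> lie at it or
  arbitrarily close to its right, where the integer-valued, right-continuous count already agrees
  with its value at the infimum.\<close>

lemma arrival_time_le_iff:
  assumes \<omega>: "\<omega> \<in> space M" and ne: "\<exists>u\<ge>0. k \<le> N u \<omega>" and "0 \<le> t"
  shows "arrival_time N k \<omega> \<le> t \<longleftrightarrow> k \<le> N t \<omega>"
proof
  let ?S = "{t. 0 \<le> t \<and> k \<le> N t \<omega>}"
  have bdd: "bdd_below ?S"
    by (intro bdd_belowI[of _ 0]) auto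
  show "arrival_time N k \<omega> \<le> t" if "k \<le> N t \<omega>"
    unfolding arrival_time_def using that \<open>0 \<le> t\<close> bdd by (intro cInf_lower) auto
  show "k \<le> N t \<omega>" if le: "arrival_time N k \<omega> \<le> t"
  proof -
    let ?T = "arrival_time N k \<omega>"
    have T0: "0 \<le> ?T"
      unfolding arrival_time_def using ne by (intro cInf_greatest) auto
    have "\<forall>\<^sub>F u in at_right ?T. N u \<omega> = N ?T \<omega>"
      using count_right_cont[OF \<omega> T0] by (simp add: continuous_within tendsto_discrete)
    then obtain b where b: "?T < b" "\<And>u. ?T < u \<Longrightarrow> u < b \<Longrightarrow> N u \<omega> = N ?T \<omega>"
      unfolding eventually_at_right_field by auto
    obtain u where u: "0 \<le> u" "k \<le> N u \<omega>" "u < b"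
      using cInf_lessD[of ?S b] ne b(1) unfolding arrival_time_def by auto
    have "?T \<le> u"
      unfolding arrival_time_def using u bdd by (intro cInf_lower) auto
    then have "N u \<omega> = N ?T \<omega>"
      using b(2)[of u] u(3) by (cases "u = ?T") auto
    then show ?thesis
      using u(2) count_le[OF \<omega> T0 le] by simp
  qed
qed

lemma arrival_time_nonneg: "\<exists>u\<ge>0. k \<le> N u \<omega> \<Longrightarrow> 0 \<le> arrival_time N k \<omega>"
  unfolding arrival_time_def by (intro cInf_greatest) auto

lemma measurable_arrival_time [measurable]: "arrival_time N k \<in> borel_measurable M"
proof (rule borel_measurableI_le)
  fix a :: real
  \<comment> \<open>By monotonicity it suffices to test integer times, which turns an uncountable
    union into a countable one.\<close>
  have reach: "(\<exists>u\<ge>0. k \<le> N u \<omega>) \<longleftrightarrow> (\<exists>m. k \<le> N (real m) \<omega>)" if "\<omega> \<in> space M" for \<omega>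
  proof
    assume "\<exists>u\<ge>0. k \<le> N u \<omega>"
    then obtain u where u: "0 \<le> u" "k \<le> N u \<omega>" by auto
    then have "k \<le> N (real (nat \<lceil>u\<rceil>)) \<omega>"
      using count_le[OF that u(1), of "real (nat \<lceil>u\<rceil>)"] by (simp add: real_nat_ceiling_ge)
    then show "\<exists>m. k \<le> N (real m) \<omega>" ..
  next
    assume "\<exists>m. k \<le> N (real m) \<omega>"
    then show "\<exists>u\<ge>0. k \<le> N u \<omega>"
      by (meson of_nat_0_le_iff)
  qed
  have empty: "arrival_time N k \<omega> = Inf {}" if "\<not> (\<exists>u\<ge>0. k \<le> N u \<omega>)" for \<omega>
    using that by (auto simp: arrival_time_def intro!: arg_cong[of _ _ Inf])
  \<comment> \<open>Paths that never reach \<open>k\<close> get the default value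
    \<open>Inf {}\<close>. On the others a negative \<open>a\<close> is never an upper bound, and
    \<open>max 0 a\<close> keeps the time in the range where \<open>N\<close> is measurable.\<close>
  have "{\<omega> \<in> space M. arrival_time N k \<omega> \<le> a}
    = {\<omega> \<in> space M. if \<exists>m. k \<le> N (real m) \<omega> then 0 \<le> a \<and> k \<le> N (max 0 a) \<omega> else Inf {} \<le> a}"
  proof (intro Collect_cong conj_cong refl)
    fix \<omega> assume \<omega>: "\<omega> \<in> space M"
    show "arrival_time N k \<omega> \<le> a \<longleftrightarrow>
      (if \<exists>m. k \<le> N (real m) \<omega> then 0 \<le> a \<and> k \<le> N (max 0 a) \<omega> else Inf {} \<le> a)"
    proof (cases "\<exists>u\<ge>0. k \<le> N u \<omega>")
      case True
      then have "0 \<le> arrival_time N k \<omega>"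
        by (rule arrival_time_nonneg)
      with True show ?thesis
        using reach[OF \<omega>] arrival_time_le_iff[OF \<omega> True, of a]
        by (cases "0 \<le> a") (simp_all add: max_def)
    next
      case False
      then show ?thesis
        using reach[OF \<omega>] empty[OF False] by simp
    qed
  qed
  also have "\<dots> \<in> sets M"
    by measurable
  finally show "{\<omega> \<in> space M. arrival_time N k \<omega> \<le> a} \<in> sets M" .
qed

text \<open>The \<open>k\<close>-th arrival is later than \<open>t\<close> exactly when fewer than
  \<open>k\<close> arrivals occur by \<open>t\<close>, so the tail is a sum of \<open>k\<close>
  Erlang densities over the rate, each contributing \<open>1 / rate\<close>.\<close>

lemma nn_integral_arrival_time:
  "(\<integral>\<^sup>+\<omega>. ennreal (arrival_time N k \<omega>) \<partial>M) = ennreal (real k / rate)"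
proof -
  let ?f = "\<lambda>j t. ennreal (erlang_density j rate t / rate)"
  have "(\<integral>\<^sup>+\<omega>. ennreal (arrival_time N k \<omega>) \<partial>M)
    = (\<integral>\<^sup>+t. ennreal (prob {\<omega> \<in> space M. t < arrival_time N k \<omega>}) * indicator {0<..} t \<partial>lborel)"
    by (rule nn_integral_eq_tail_integral) measurable
  also have "\<dots> = (\<integral>\<^sup>+t. (\<Sum>j<k. ?f j t) \<partial>lborel)"
  \<comment> \<open>The point 0 is removed because the indicator vanishes there, while the Erlang
    density of index 0 equals \<open>rate\<close>.\<close>
  proof (rule nn_integral_cong_AE, rule AE_mp[OF AE_lborel_singleton[of 0]], intro AE_I2 impI)
    fix t :: real assume "t \<noteq> 0"
    show "ennreal (prob {\<omega> \<in> space M. t < arrival_time N k \<omega>}) * indicator {0<..} t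
      = (\<Sum>j<k. ?f j t)"
    proof (cases "0 < t")
      case True
      have [measurable]: "N t \<in> measurable M (count_space UNIV)"
        using True by (intro measurable_count) simp
      \<comment> \<open>The two events may differ on the null set of bounded paths, where the
        arrival time is a default value.\<close>
      have "prob {\<omega> \<in> space M. t < arrival_time N k \<omega>} = prob {\<omega> \<in> space M. N t \<omega> < k}"
      proof (rule finite_measure_eq_AE)
        show "AE \<omega> in M. \<omega> \<in> {\<omega> \<in> space M. t < arrival_time N k \<omega>}
          \<longleftrightarrow> \<omega> \<in> {\<omega> \<in> space M. N t \<omega> < k}"
          using AE_count_unbounded
        proof (rule AE_mp, intro AE_I2 impI)
          fix \<omega> assume "\<omega> \<in> space M" "\<forall>k. \<exists>t\<ge>0. k \<le> N t \<omega>"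
          then show "\<omega> \<in> {\<omega> \<in> space M. t < arrival_time N k \<omega>}
            \<longleftrightarrow> \<omega> \<in> {\<omega> \<in> space M. N t \<omega> < k}"
            using arrival_time_le_iff[of \<omega> k t] True by (auto simp: not_le[symmetric])
        qed
      qed measurable
      then show ?thesis
        using True rate_pos by (simp add: prob_count_less sum_divide_distrib sum_ennreal)
    next
      case False
      then show ?thesis
        using \<open>t \<noteq> 0\<close> by (simp add: erlang_density_def)
    qed
  qed
  also have "\<dots> = (\<Sum>j<k. \<integral>\<^sup>+t. ?f j t \<partial>lborel)"
    by (rule nn_integral_sum) measurable
  also have "\<dots> = (\<Sum>j<k. ennreal (1 / rate))"
  proof (rule sum.cong[OF refl])
    fix j
    have "(\<integral>\<^sup>+t. ?f j t \<partial>lborel)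
      = (\<integral>\<^sup>+t. ennreal (1 / rate) * ennreal (erlang_density j rate t) \<partial>lborel)"
      using rate_pos by (intro nn_integral_cong) (simp add: ennreal_mult[symmetric])
    also have "\<dots> = ennreal (1 / rate) * (\<integral>\<^sup>+t. ennreal (erlang_density j rate t) \<partial>lborel)"
      by (rule nn_integral_cmult) measurable
    \<comment> \<open>The zeroth moment of the Erlang density is its total mass 1.\<close>
    finally show "(\<integral>\<^sup>+t. ?f j t \<partial>lborel) = ennreal (1 / rate)"
      using nn_integral_erlang_ith_moment[of rate j 0] rate_pos by simp
  qed
  also have "\<dots> = ennreal (real k / rate)"
    using rate_pos by (subst sum_ennreal) auto
  finally show ?thesis .
qed

section \<open>Almost sure distinctness of the arrivals\<close>

text \<open>An interval of length \<open>l\<close> has at least two arrivals with probability at most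
  \<open>(rate * l)\<^sup>2\<close>, so by a union bound over ever finer subdivisions no two arrivals coincide.\<close>

lemma AE_ex_subdivision:
  assumes "0 < L"
  shows "AE \<omega> in M. \<exists>m. \<forall>j<Suc m.
    N (real (Suc j) * L / real (Suc m)) \<omega> - N (real j * L / real (Suc m)) \<omega> < 2"
proof -
  define inc where "inc m j \<omega> =
    N (real (Suc j) * L / real (Suc m)) \<omega> - N (real j * L / real (Suc m)) \<omega>" for m j \<omega>
  let ?C = "\<lambda>m. \<Union>j<Suc m. {\<omega> \<in> space M. \<not> inc m j \<omega> < 2}"
  have [measurable]: "inc m j \<in> measurable M (count_space UNIV)" for m j
  proof -
    have [measurable]: "N (real j * L / real (Suc m)) \<in> measurable M (count_space UNIV)" for j m
      using assms by (intro measurable_count) simp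
    show ?thesis
      unfolding inc_def by measurable
  qed
  have cell: "prob {\<omega> \<in> space M. \<not> inc m j \<omega> < 2} \<le> (rate * L / real (Suc m))\<^sup>2" for m j
  proof -
    let ?h = "rate * L / real (Suc m)"
    have h: "0 \<le> ?h"
      using assms rate_pos by simp
    have len: "real (Suc j) * L / real (Suc m) - real j * L / real (Suc m) = L / real (Suc m)"
      by (simp add: diff_divide_distrib[symmetric] left_diff_distrib[symmetric])
    have "prob {\<omega> \<in> space M. \<not> inc m j \<omega> < 2} = 1 - prob {\<omega> \<in> space M. inc m j \<omega> < 2}"
      by (rule prob_neg) measurable
    also have "prob {\<omega> \<in> space M. inc m j \<omega> < 2} = (1 + ?h) * exp (- ?h)"
    proof -
      have "0 < L / real (Suc m)"
        using assms by simp
      then have "real j * L / real (Suc m) < real (Suc j) * L / real (Suc m)"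
        using len by linarith
      then have "prob {\<omega> \<in> space M. inc m j \<omega> < 2}
        = (\<Sum>i<2. (rate * (L / real (Suc m))) ^ i / fact i * exp (- (rate * (L / real (Suc m)))))"
        unfolding inc_def using assms by (subst prob_increment_less) (simp_all only: len, simp)
      then show ?thesis
        by (simp add: numeral_2_eq_2 distrib_right del: of_nat_Suc)
    qed
    \<comment> \<open>Here \<open>?h\<close> is the expected number of arrivals in one cell; the
      bound is \<open>exp (- ?h) \<ge> 1 - ?h\<close>.\<close>
    also have "1 - (1 + ?h) * exp (- ?h) \<le> 1 - (1 + ?h) * (1 - ?h)"
      using mult_left_mono[OF exp_ge_add_one_self[of "- ?h"], of "1 + ?h"] h by simp
    also have "\<dots> = ?h\<^sup>2"
      by (simp add: algebra_simps power2_eq_square)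
    finally show ?thesis .
  qed
  \<comment> \<open>There are \<open>m + 1\<close> cells, each with a bound of order
    \<open>1 / (m + 1)^2\<close>, so the total is of order \<open>1 / (m + 1)\<close>.\<close>
  have "prob (?C m) \<le> (rate * L)\<^sup>2 / real (Suc m)" for m
  proof -
    have "prob (?C m) \<le> (\<Sum>j<Suc m. prob {\<omega> \<in> space M. \<not> inc m j \<omega> < 2})"
      by (rule finite_measure_subadditive_finite) auto
    also have "\<dots> \<le> (\<Sum>j<Suc m. (rate * L / real (Suc m))\<^sup>2)"
      by (intro sum_mono cell)
    also have "\<dots> = (rate * L)\<^sup>2 / real (Suc m)"
      by (simp add: power2_eq_square divide_simps del: of_nat_Suc)
    finally show ?thesis .
  qed
  moreover have "(\<lambda>m. (rate * L)\<^sup>2 / real (Suc m)) \<longlonglongrightarrow> 0"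
    by (rule LIMSEQ_Suc[OF lim_const_over_n])
  ultimately have "AE \<omega> in M. \<exists>m. \<omega> \<notin> ?C m"
    by (intro AE_ex_notin) measurable
  then show ?thesis
  proof (rule AE_mp, intro AE_I2 impI)
    fix \<omega> assume "\<omega> \<in> space M" "\<exists>m. \<omega> \<notin> ?C m"
    then obtain m where "\<forall>j<Suc m. inc m j \<omega> < 2"
      by blast
    then show "\<exists>m. \<forall>j<Suc m.
      N (real (Suc j) * L / real (Suc m)) \<omega> - N (real j * L / real (Suc m)) \<omega> < 2"
      unfolding inc_def ..
  qed
qed

text \<open>If arrivals \<open>k\<close> and \<open>k + 1\<close> coincided, the count would jump by
  at least 2 across every cell containing their common time in its interior or at its right end,
  contradicting a sufficiently fine subdivision.\<close>

lemma AE_arrival_time_less_Suc: "AE \<omega> in M. \<forall>k\<ge>1. arrival_time N k \<omega> < arrival_time N (Suc k) \<omega>"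
proof -
  \<comment> \<open>All integer horizons are treated at once, since the horizon must exceed a random
    time.\<close>
  have "AE \<omega> in M. \<forall>l. \<exists>m. \<forall>j<Suc m. N (real (Suc j) * real (Suc l) / real (Suc m)) \<omega>
    - N (real j * real (Suc l) / real (Suc m)) \<omega> < 2"
    unfolding AE_all_countable by (intro allI AE_ex_subdivision) simp
  with AE_count_unbounded AE_space show ?thesis
  proof eventually_elim
    case (elim \<omega>)
    have le_iff: "arrival_time N k \<omega> \<le> t \<longleftrightarrow> k \<le> N t \<omega>" if "0 \<le> t" for k t
      using arrival_time_le_iff[OF elim(2) _ that, of k] elim(1) by blast
    show "\<forall>k\<ge>1. arrival_time N k \<omega> < arrival_time N (Suc k) \<omega>"
    proof (intro allI impI, rule ccontr)
      fix k :: nat assume "1 \<le> k"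
      define T where "T = arrival_time N k \<omega>"
      define l where "l = nat \<lceil>T\<rceil>"
      assume "\<not> arrival_time N k \<omega> < arrival_time N (Suc k) \<omega>"
      then have Suc_le: "arrival_time N (Suc k) \<omega> \<le> T"
        by (simp add: T_def)
      have "0 < T"
        using le_iff[of 0 k] count_0[OF elim(2)] \<open>1 \<le> k\<close> by (simp add: T_def not_le[symmetric])
      have "T < real (Suc l)"
        unfolding l_def by linarith
      obtain m where m: "\<And>j. j < Suc m \<Longrightarrow> N (real (Suc j) * real (Suc l) / real (Suc m)) \<omega>
          - N (real j * real (Suc l) / real (Suc m)) \<omega> < 2"
        using elim(3) by blast
      \<comment> \<open>\<open>c\<close> is \<open>T\<close> in units of the cell length. Rounding
        up and subtracting 1 puts \<open>T\<close> in a cell open on the left and closed on the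
        right, because by right-continuity a jump at a grid point already counts at that
        point.\<close>
      define c where "c = T * real (Suc m) / real (Suc l)"
      have "0 < c" and "c < real (Suc m)"
        using \<open>0 < T\<close> \<open>T < real (Suc l)\<close>
        by (simp_all add: c_def pos_divide_less_eq mult.commute[of T] del: of_nat_Suc)
      define j where "j = nat (\<lceil>c\<rceil> - 1)"
      have j: "real j < c" "c \<le> real (Suc j)"
        using \<open>0 < c\<close> unfolding j_def by linarith+
      then have "j < Suc m"
        using \<open>c < real (Suc m)\<close> by linarith
      have "real j * real (Suc l) / real (Suc m) < T" "T \<le> real (Suc j) * real (Suc l) / real (Suc m)"
        using j by (simp_all add: c_def pos_divide_less_eq pos_less_divide_eq pos_divide_le_eq
            pos_le_divide_eq del: of_nat_Suc)
      then have "N (real j * real (Suc l) / real (Suc m)) \<omega> < k"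
        and "Suc k \<le> N (real (Suc j) * real (Suc l) / real (Suc m)) \<omega>"
        using le_iff[of "real j * real (Suc l) / real (Suc m)" k] Suc_le
          le_iff[of "real (Suc j) * real (Suc l) / real (Suc m)" "Suc k"]
        by (simp_all add: T_def del: of_nat_Suc)
      then show False
        using m[OF \<open>j < Suc m\<close>] by linarith
    qed
  qed
qed

section \<open>The initial configuration and its expected sum\<close>

text \<open>The conditions on an algorithm speak only about initial configurations, so this is what
  allows them to be applied to the random input.\<close>

lemma AE_initial_configuration: "AE \<omega> in M. initial_configuration n (first_arrivals N n \<omega>)"
  using AE_count_unbounded AE_arrival_time_less_Suc
proof eventually_elim
  case (elim \<omega>)
  have "sorted_wrt (<) (first_arrivals N n \<omega>)"
    unfolding first_arrivals_def sorted_wrt_iff_nth_less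
  proof (intro allI impI)
    fix i j assume ij: "i < j" "j < length (map (\<lambda>k. arrival_time N k \<omega>) [1..<Suc n])"
    \<comment> \<open>List position \<open>i\<close> holds arrival \<open>Suc i\<close>; the shift
      also matches the strict increase, which is stated from index 1 on.\<close>
    have "arrival_time N (Suc i) \<omega> < arrival_time N (Suc j) \<omega>"
      by (rule lift_Suc_mono_less[of "\<lambda>k. arrival_time N (Suc k) \<omega>"])
        (use elim(2) ij(1) in simp_all)
    then show "map (\<lambda>k. arrival_time N k \<omega>) [1..<Suc n] ! i
      < map (\<lambda>k. arrival_time N k \<omega>) [1..<Suc n] ! j"
      using ij by (simp del: upt_Suc)
  qed
  moreover have "set (first_arrivals N n \<omega>) \<subseteq> {0..}"
    using elim(1) arrival_time_nonneg by (auto simp: first_arrivals_def)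
  ultimately show ?case
    by (simp add: initial_configuration_def first_arrivals_def)
qed

lemma sum_list_first_arrivals:
  "sum_list (first_arrivals N n \<omega>) = (\<Sum>k=1..n. arrival_time N k \<omega>)"
  by (simp add: first_arrivals_def sum_list_distinct_conv_sum_set atLeastLessThanSuc_atLeastAtMost
      del: upt_Suc)

lemma nn_integral_sum_list_first_arrivals:
  "(\<integral>\<^sup>+\<omega>. ennreal (sum_list (first_arrivals N n \<omega>)) \<partial>M)
    = ennreal (real n * (real n + 1) / (2 * rate))"
proof -
  have "(\<integral>\<^sup>+\<omega>. ennreal (sum_list (first_arrivals N n \<omega>)) \<partial>M)
    = (\<integral>\<^sup>+\<omega>. (\<Sum>k=1..n. ennreal (arrival_time N k \<omega>)) \<partial>M)"
  \<comment> \<open>Moving \<open>ennreal\<close> inside the sum requires nonnegative arrival times,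
    which hold almost surely.\<close>
  proof (rule nn_integral_cong_AE, use AE_count_unbounded in eventually_elim)
    case (elim \<omega>)
    then show ?case
      by (simp add: sum_list_first_arrivals sum_ennreal arrival_time_nonneg)
  qed
  also have "\<dots> = (\<Sum>k=1..n. ennreal (real k / rate))"
    by (simp add: nn_integral_sum nn_integral_arrival_time)
  also have "\<dots> = ennreal (\<Sum>k=1..n. real k / rate)"
    using rate_pos by (intro sum_ennreal) simp
  also have "(\<Sum>k=1..n. real k / rate) = real n * (real n + 1) / (2 * rate)"
  proof -
    have "(\<Sum>k=1..n. real k) = real n * (real n + 1) / 2"
      by (induction n) (simp_all add: field_simps)
    then show ?thesis
      by (simp only: sum_divide_distrib[symmetric] divide_divide_eq_left)
  qed
  finally show ?thesis .
qed

end

section \<open>Deterministic bounds on positions and movement\<close>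

text \<open>The least entry is nonnegative and each gap adds \<open>s\<close>, so the entry of rank
  \<open>k\<close>, counted from 0, is at least \<open>k * s\<close>; sorting preserves the
  sum.\<close>

lemma sum_list_ge_of_sorted_gaps:
  fixes y :: "real list"
  assumes "set y \<subseteq> {0..}"
    and gaps: "\<And>k. Suc k < length y \<Longrightarrow> s \<le> sort y ! Suc k - sort y ! k"
  shows "s * (real (length y) * (real (length y) - 1) / 2) \<le> sum_list y"
proof -
  have nth_ge: "real k * s \<le> sort y ! k" if "k < length y" for k
    using that
  proof (induction k)
    case 0
    then have "sort y ! 0 \<in> set (sort y)"
      by (intro nth_mem) simp
    then show ?case
      using assms(1) by auto
  next
    case (Suc k)
    then show ?case
      using gaps[of k] by (simp add: algebra_simps)
  qed
  have "(\<Sum>k<n. real k * s) = s * (real n * (real n - 1) / 2)" for n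
    by (induction n) (simp_all add: algebra_simps add_divide_distrib)
  then have "s * (real (length y) * (real (length y) - 1) / 2) = (\<Sum>k<length y. real k * s)"
    by simp
  also have "\<dots> \<le> (\<Sum>k<length y. sort y ! k)"
    by (intro sum_mono nth_ge) simp
  also have "\<dots> = sum_list (sort y)"
    by (simp add: sum_list_sum_nth atLeast0LessThan)
  also have "\<dots> = sum_list y"
    by (metis mset_sort sum_mset_sum_list)
  finally show ?thesis .
qed

lemma total_movement_ge_diff:
  assumes "length y = length x"
  shows "sum_list y - sum_list x \<le> total_movement x y"
  using assms unfolding total_movement_def
  by (auto simp: sum_list_sum_nth atLeast0LessThan sum_subtractf[symmetric] intro!: sum_mono)

section \<open>The lower bound in expectation\<close>

theorem theorem7:
  fixes \<epsilon> \<tau> :: real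
    and M :: "nat \<Rightarrow> 'w measure"
    and N :: "nat \<Rightarrow> real \<Rightarrow> 'w \<Rightarrow> nat"
    and A :: "real list \<Rightarrow> real list"
  assumes "0 < \<epsilon>" and "\<epsilon> \<le> \<tau>"
    and "\<And>n. 1 \<le> n \<Longrightarrow> poisson_process (M n) (real n) (N n)"
    and "displacement_algorithm A"
    and "\<And>n. 1 \<le> n \<Longrightarrow> solves_interference n ((1 + \<epsilon>) / real n) ((1 + \<tau>) / real n) A"
  shows "\<exists>c>0. \<forall>\<^sub>F n in sequentially.
           ennreal (c * real n) \<le> expected_movement (M n) (N n) n A"
\<comment> \<open>Final minus expected initial sum is at least
  \<open>(\<epsilon> * n - \<epsilon> - 2) / 2\<close>. Halving the leading coefficient
  \<open>\<epsilon> / 2\<close> absorbs the constants once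
  \<open>n \<ge> (2 * \<epsilon> + 4) / \<epsilon>\<close>.\<close>
proof (intro exI[of _ "\<epsilon> / 4"] conjI)
  show "0 < \<epsilon> / 4"
    using assms(1) by simp
  show "\<forall>\<^sub>F n in sequentially. ennreal (\<epsilon> / 4 * real n) \<le> expected_movement (M n) (N n) n A"
    using eventually_ge_at_top[of 1] eventually_ge_at_top[of "nat \<lceil>(2 * \<epsilon> + 4) / \<epsilon>\<rceil>"]
  proof eventually_elim
    case (elim n)
    interpret poisson_process "M n" "real n" "N n"
      using assms(3) elim(1) .
    let ?x = "first_arrivals (N n) n"
    define a where "a = (1 + \<epsilon>) * (real n - 1) / 2"
    have move: "a \<le> total_movement x (A x) + sum_list x" if x: "initial_configuration n x" for x
    proof -
      have A: "length (A x) = n" "set (A x) \<subseteq> {0..}"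
        using assms(4) x unfolding displacement_algorithm_def by blast+
      have "consecutive_distances_within ((1 + \<epsilon>) / real n) ((1 + \<tau>) / real n) (A x)"
        using assms(5)[OF elim(1)] x unfolding solves_interference_def by blast
      then have "(1 + \<epsilon>) / real n * (real (length (A x)) * (real (length (A x)) - 1) / 2)
        \<le> sum_list (A x)"
        using A by (intro sum_list_ge_of_sorted_gaps) (auto simp: consecutive_distances_within_def)
      then have "a \<le> sum_list (A x)"
        using A elim(1) by (simp add: a_def)
      then show ?thesis
        using total_movement_ge_diff[of "A x" x] A x by (simp add: initial_configuration_def)
    qed
    have [measurable]: "(\<lambda>\<omega>. sum_list (?x \<omega>)) \<in> borel_measurable (M n)"
      unfolding sum_list_first_arrivals by measurable
    \<comment> \<open>The movement may be non-measurable. Additivity of the integral is therefore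
      used only for functions of the measurable initial sum, and the movement enters afterwards by
      monotonicity.\<close>
    have "ennreal a = (\<integral>\<^sup>+\<omega>. ennreal a \<partial>M n)"
      by (simp add: emeasure_space_1)
    also have "\<dots> \<le> (\<integral>\<^sup>+\<omega>. ennreal (a - sum_list (?x \<omega>)) + ennreal (sum_list (?x \<omega>)) \<partial>M n)"
    proof (rule nn_integral_mono)
      fix \<omega>
      \<comment> \<open>Since \<open>ennreal\<close> truncates, the inequality is proved for
        positive parts.\<close>
      have "ennreal a \<le> ennreal (max 0 (a - sum_list (?x \<omega>)) + max 0 (sum_list (?x \<omega>)))"
        by (intro ennreal_leI) auto
      also have "\<dots> = ennreal (max 0 (a - sum_list (?x \<omega>))) + ennreal (max 0 (sum_list (?x \<omega>)))"
        by (rule ennreal_plus) auto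
      finally show "ennreal a \<le> ennreal (a - sum_list (?x \<omega>)) + ennreal (sum_list (?x \<omega>))"
        by simp
    qed
    also have "\<dots> = (\<integral>\<^sup>+\<omega>. ennreal (a - sum_list (?x \<omega>)) \<partial>M n)
        + (\<integral>\<^sup>+\<omega>. ennreal (sum_list (?x \<omega>)) \<partial>M n)"
      by (rule nn_integral_add) measurable
    also have "\<dots> \<le> expected_movement (M n) (N n) n A + ennreal ((real n + 1) / 2)"
    proof (rule add_mono)
      show "(\<integral>\<^sup>+\<omega>. ennreal (a - sum_list (?x \<omega>)) \<partial>M n) \<le> expected_movement (M n) (N n) n A"
        unfolding expected_movement_def
      proof (rule nn_integral_mono_AE, use AE_initial_configuration[of n] in eventually_elim)
        case (elim \<omega>)
        then show ?case
          using move[OF elim] by (intro ennreal_leI) simp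
      qed
      show "(\<integral>\<^sup>+\<omega>. ennreal (sum_list (?x \<omega>)) \<partial>M n) \<le> ennreal ((real n + 1) / 2)"
        using elim(1) by (simp add: nn_integral_sum_list_first_arrivals)
    qed
    finally have "ennreal a - ennreal ((real n + 1) / 2) \<le> expected_movement (M n) (N n) n A"
      by (simp add: ennreal_minus_le_iff add.commute)
    then have "ennreal (a - (real n + 1) / 2) \<le> expected_movement (M n) (N n) n A"
      by (simp add: ennreal_minus)
    moreover have "\<epsilon> / 4 * real n \<le> a - (real n + 1) / 2"
    proof -
      have "(2 * \<epsilon> + 4) / \<epsilon> \<le> real n"
        using elim(2) by linarith
      then show ?thesis
        using assms(1) by (simp add: a_def field_simps)
    qed
    ultimately show ?case
      by (meson ennreal_leI order_trans)
  qed
qed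

end
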